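(* Consider the distributed detection system with $N$ sensors under data falsification attacks described in the context, in which the fusion center (FC) compares the number of received ones with a threshold $T$ through the rule $$\sum_{i=1}^N u_i\ \overset{\mathcal H_1}{\underset{\mathcal H_0}{\gtrless}}\ T .$$ Using this rule, the detection performance of the system with energy-efficient ordered transmission (EEOT), which is evaluated as that of the corresponding system without ordering, is given by the probability of detection and the probability of false alarm of the FC $$P_{d,EEOT}^{FC}=\sum_{i=T+1}^{N}\binom{N}{i}\widetilde{\pi}_{1,1}^{\,i}\,\widetilde{\pi}_{0,1}^{\,N-i},\qquad P_{f,EEOT}^{FC}=\sum_{i=T+1}^{N}\binom{N}{i}\widetilde{\pi}_{1,0}^{\,i}\,\widetilde{\pi}_{0,0}^{\,N-i},$$ where $\widetilde{\pi}_{1,h}=\alpha p\,\pi_{0,h}+(1-\alpha p)\,\pi_{1,h}$ and $\widetilde{\pi}_{0,h}=1-\widetilde{\pi}_{1,h}$ for $h=0,1$.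
   Context: Model. Hypotheses $\mathcal{H}_0,\mathcal{H}_1$ have prior probabilities $\pi_0,\pi_1$. There are $N$ sensors. Conditionally on the hypothesis, the observations $y_1,\dots,y_N$ are i.i.d., with $y_i\sim\mathcal{N}(0,\sigma^2)$ under $\mathcal{H}_0$ and $y_i\sim\mathcal{N}(s,\sigma^2)$ under $\mathcal{H}_1$, where $s$ is the signal strength. Sensor $i$ computes the log-likelihood ratio $L_i=\log\big(f(y_i|\mathcal{H}_1)/f(y_i|\mathcal{H}_0)\big)$ and makes the local decision $v_i=1$ if $L_i>\lambda$ and $v_i=0$ if $L_i<\lambda$, with $\lambda=\log(\pi_0/\pi_1)$. Write $\pi_{j,h}=\Pr(v_i=j|\mathcal{H}_h)$ for $j,h\in\{0,1\}$. Attack. Each sensor is malicious with probability $\alpha$, and a malicious sensor flips its decision with probability $p$. Thus the decision $u_i$ sent to the FC is $u_i=1-v_i$ with probability $\alpha p$ and $u_i=v_i$ with probability $1-\alpha p$, so that $\widetilde\pi_{j,h}=\Pr(u_i=j|\mathcal H_h)$. Systems. In the system without ordering the FC uses all $N$ decisions $u_1,\dots,u_N$ in the rule displayed in the claim. In the EEOT system the sensors transmit in decreasing order of $|L_i|$, the FC receiving $u_{[1]},u_{[2]},\dots$, and the FC stops further transmissions as soon as it can decide: $\mathcal{H}_1$ if $\sum_{i=1}^k u_{[i]}\ge T$, $\mathcal{H}_0$ if $\sum_{i=1}^k u_{[i]}<T-(N-k)$. The two systems have the same detection performance. The probability of detection is $\Pr(\text{decide }\mathcal{H}_1|\mathcal{H}_1)$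 and the probability of false alarm is $\Pr(\text{decide }\mathcal{H}_1|\mathcal{H}_0)$.
   Formalization: A count equal to T is decided as H_0: the formulas are proved for the rules "H_1 if sum > T" and, in EEOT, "H_0 if sum ≤ T-(N-k)", instead of the context's ≥ T and < T-(N-k), under which the sums would have to start at i = T. *)

theory Defs
  imports "HOL-Probability.Probability"
begin

text \<open>
  One probability space carries the hypothesis, the observations and the attack. The flag
  \<open>mal i\<close> says that sensor \<open>i\<close> is malicious; \<open>flp i\<close> is the outcome of the coin deciding whether
  sensor \<open>i\<close> would flip if it is malicious. Sensors are numbered \<open>0, \<dots>, N - 1\<close>.
\<close>

record 'a detection_system =
  pspace :: "'a measure"
  hyp :: "'a \<Rightarrow> nat"
  obs :: "nat \<Rightarrow> 'a \<Rightarrow> real"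
  mal :: "nat \<Rightarrow> 'a \<Rightarrow> bool"
  flp :: "nat \<Rightarrow> 'a \<Rightarrow> bool"
  nsensors :: nat
  signal :: real
  noise :: real
  p_mal :: real
  p_flip :: real

definition prior :: "'a detection_system \<Rightarrow> nat \<Rightarrow> real" where
  "prior S h = \<P>(\<omega> in pspace S. hyp S \<omega> = h)"

definition given_hyp :: "'a detection_system \<Rightarrow> nat \<Rightarrow> 'a measure" where
  "given_hyp S h = uniform_measure (pspace S) {\<omega> \<in> space (pspace S). hyp S \<omega> = h}"

definition obs_mean :: "'a detection_system \<Rightarrow> nat \<Rightarrow> real" where
  "obs_mean S h = (if h = 1 then signal S else 0)"

abbreviation sensor_space :: "(real \<times> bool \<times> bool) measure" where
  "sensor_space \<equiv> borel \<Otimes>\<^sub>M (count_space UNIV \<Otimes>\<^sub>M count_space UNIV)"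

abbreviation sensor_data :: "'a detection_system \<Rightarrow> nat \<Rightarrow> 'a \<Rightarrow> real \<times> bool \<times> bool" where
  "sensor_data S i \<omega> \<equiv> (obs S i \<omega>, mal S i \<omega>, flp S i \<omega>)"

text \<open>
  Conditionally on each hypothesis, the sensors are i.i.d., and within a sensor the observation,
  the malicious flag and the flip coin are independent: the joint law is a product measure.
\<close>

definition detection_model :: "'a detection_system \<Rightarrow> bool" where
  "detection_model S \<longleftrightarrow>
     prob_space (pspace S) \<and>
     1 \<le> nsensors S \<and> 0 < noise S \<and>
     0 \<le> p_mal S \<and> p_mal S \<le> 1 \<and> 0 \<le> p_flip S \<and> p_flip S \<le> 1 \<and>
     hyp S \<in> pspace S \<rightarrow>\<^sub>M count_space UNIV \<and>
     (\<forall>\<omega>\<in>space (pspace S). hyp S \<omega> \<in> {0, 1}) \<and>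
     0 < prior S 0 \<and> 0 < prior S 1 \<and>
     (\<forall>i<nsensors S. sensor_data S i \<in> pspace S \<rightarrow>\<^sub>M sensor_space) \<and>
     (\<forall>h\<in>{0, 1}.
        prob_space.indep_vars (given_hyp S h) (\<lambda>_. sensor_space) (sensor_data S) {..<nsensors S} \<and>
        (\<forall>i<nsensors S.
           distr (given_hyp S h) sensor_space (sensor_data S i) =
             density lborel (normal_density (obs_mean S h) (noise S)) \<Otimes>\<^sub>M
               (measure_pmf (bernoulli_pmf (p_mal S)) \<Otimes>\<^sub>M
                measure_pmf (bernoulli_pmf (p_flip S)))))"

definition llr :: "'a detection_system \<Rightarrow> nat \<Rightarrow> 'a \<Rightarrow> real" where
  "llr S i \<omega> = ln (normal_density (obs_mean S 1) (noise S) (obs S i \<omega>) /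
                    normal_density (obs_mean S 0) (noise S) (obs S i \<omega>))"

definition local_threshold :: "'a detection_system \<Rightarrow> real" where
  "local_threshold S = ln (prior S 0 / prior S 1)"

text \<open>The case of equality, left open by the model, is resolved as 0 (a null event if the signal
  is nonzero).\<close>

definition local_decision :: "'a detection_system \<Rightarrow> nat \<Rightarrow> 'a \<Rightarrow> nat" where
  "local_decision S i \<omega> = (if llr S i \<omega> > local_threshold S then 1 else 0)"

definition sent_decision :: "'a detection_system \<Rightarrow> nat \<Rightarrow> 'a \<Rightarrow> nat" where
  "sent_decision S i \<omega> =
     (if mal S i \<omega> \<and> flp S i \<omega> then 1 - local_decision S i \<omega> else local_decision S i \<omega>)"

definition pi_local :: "'a detection_system \<Rightarrow> nat \<Rightarrow> nat \<Rightarrow> nat \<Rightarrow> real" where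
  "pi_local S i j h = \<P>(\<omega> in pspace S. local_decision S i \<omega> = j \<bar> hyp S \<omega> = h)"

definition pi_sent :: "'a detection_system \<Rightarrow> nat \<Rightarrow> nat \<Rightarrow> nat \<Rightarrow> real" where
  "pi_sent S i j h = \<P>(\<omega> in pspace S. sent_decision S i \<omega> = j \<bar> hyp S \<omega> = h)"

text \<open>
  Both fusion rules take the comparison \<open>R\<close> as a parameter, to be instantiated by \<open>(>)\<close> (a count
  equal to \<open>T\<close> is decided as hypothesis 0) or by \<open>(\<ge>)\<close> (decided as hypothesis 1). The negated
  comparison is the one in favour of hypothesis 0, so for \<open>(\<ge>)\<close> the two stopping
  conditions read \<open>\<Sum> \<ge> T\<close> and \<open>\<Sum> < T - (N - k)\<close>. Integers are used because \<open>T - (N - k)\<close> may be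
  negative.
\<close>

definition unordered_decides_H1 ::
    "'a detection_system \<Rightarrow> (int \<Rightarrow> int \<Rightarrow> bool) \<Rightarrow> nat \<Rightarrow> 'a \<Rightarrow> bool" where
  "unordered_decides_H1 S R T \<omega> \<longleftrightarrow> R (int (\<Sum>i<nsensors S. sent_decision S i \<omega>)) (int T)"

text \<open>Ties in the magnitude of the log-likelihood ratio are broken by sensor number
  (\<open>sort_key\<close> is stable).\<close>

definition transmission_order :: "'a detection_system \<Rightarrow> 'a \<Rightarrow> nat list" where
  "transmission_order S \<omega> = sort_key (\<lambda>i. - \<bar>llr S i \<omega>\<bar>) [0..<nsensors S]"

definition received_ones :: "'a detection_system \<Rightarrow> nat \<Rightarrow> 'a \<Rightarrow> int" where
  "received_ones S k \<omega> =
     int (\<Sum>i\<leftarrow>take k (transmission_order S \<omega>). sent_decision S i \<omega>)"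

definition eeot_can_decide_H1 ::
    "'a detection_system \<Rightarrow> (int \<Rightarrow> int \<Rightarrow> bool) \<Rightarrow> nat \<Rightarrow> nat \<Rightarrow> 'a \<Rightarrow> bool" where
  "eeot_can_decide_H1 S R T k \<omega> \<longleftrightarrow> R (received_ones S k \<omega>) (int T)"

definition eeot_can_decide_H0 ::
    "'a detection_system \<Rightarrow> (int \<Rightarrow> int \<Rightarrow> bool) \<Rightarrow> nat \<Rightarrow> nat \<Rightarrow> 'a \<Rightarrow> bool" where
  "eeot_can_decide_H0 S R T k \<omega> \<longleftrightarrow>
     \<not> R (received_ones S k \<omega>) (int T - (int (nsensors S) - int k))"

definition eeot_stop ::
    "'a detection_system \<Rightarrow> (int \<Rightarrow> int \<Rightarrow> bool) \<Rightarrow> nat \<Rightarrow> 'a \<Rightarrow> nat" where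
  "eeot_stop S R T \<omega> =
     (LEAST k. 1 \<le> k \<and> (eeot_can_decide_H1 S R T k \<omega> \<or> eeot_can_decide_H0 S R T k \<omega>))"

definition eeot_decides_H1 ::
    "'a detection_system \<Rightarrow> (int \<Rightarrow> int \<Rightarrow> bool) \<Rightarrow> nat \<Rightarrow> 'a \<Rightarrow> bool" where
  "eeot_decides_H1 S R T \<omega> \<longleftrightarrow> eeot_can_decide_H1 S R T (eeot_stop S R T \<omega>) \<omega>"

definition prob_detection :: "'a detection_system \<Rightarrow> ('a \<Rightarrow> bool) \<Rightarrow> real" where
  "prob_detection S decides_H1 = \<P>(\<omega> in pspace S. decides_H1 \<omega> \<bar> hyp S \<omega> = 1)"

definition prob_false_alarm :: "'a detection_system \<Rightarrow> ('a \<Rightarrow> bool) \<Rightarrow> real" where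
  "prob_false_alarm S decides_H1 = \<P>(\<omega> in pspace S. decides_H1 \<omega> \<bar> hyp S \<omega> = 0)"

end

theory Submission imports Defs begin

text \<open>
  After \<open>k\<close> transmissions the ones still to be received number between 0 and \<open>N - k\<close>, so the decision
  of the ordered system agrees with the unordered one on every outcome. Conditionally on a
  hypothesis, the sent decisions are the same function of the i.i.d. sensor data, so their sum is
  binomial.
\<close>

section \<open>The number of independent, equally likely events that occur\<close>

lemma (in prob_space) prob_card_indep_events:
  fixes X :: "'i \<Rightarrow> 'a \<Rightarrow> bool"
  assumes indep: "indep_vars (\<lambda>_. count_space UNIV) X I" and fin: "finite I"
    and q: "\<And>i. i \<in> I \<Longrightarrow> prob {\<omega> \<in> space M. X i \<omega>} = q"
  shows "prob {\<omega> \<in> space M. P (card {i \<in> I. X i \<omega>})} =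
    (\<Sum>k | k \<le> card I \<and> P k. real (card I choose k) * q ^ k * (1 - q) ^ (card I - k))"
proof -
  \<comment> \<open>\<open>E A\<close> says that precisely the indices in \<open>A\<close> succeed.
    These cells are disjoint, the event in question is the union of those with
    \<open>P (card A)\<close>, and independence makes the probability of a cell depend on
    \<open>card A\<close> alone.\<close>
  define E where "E A = {\<omega> \<in> space M. {i \<in> I. X i \<omega>} = A}" for A
  have meas: "Measurable.pred M (X i)" if "i \<in> I" for i
    using indep that by (auto simp: indep_vars_def)
  have E_eq: "E A = {\<omega> \<in> space M. \<forall>i\<in>I. X i \<omega> = (i \<in> A)}" if "A \<subseteq> I" for A
    using that by (auto simp: E_def)
  have E_sets: "E A \<in> events" if "A \<subseteq> I" for A
  proof -
    have "{\<omega> \<in> space M. X i \<omega> = (i \<in> A)} \<in> events" if "i \<in> I" for i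
      using meas[OF that] by measurable
    then show ?thesis
      unfolding E_eq[OF that] using fin by (intro sets.sets_Collect_finite_All) auto
  qed
  have prob_E: "prob (E A) = q ^ card A * (1 - q) ^ (card I - card A)" if A: "A \<subseteq> I" for A
  \<comment> \<open>\<open>indep_varsD\<close> asks for a nonempty index set, since an empty
    intersection would not be \<open>space M\<close>. For empty \<open>I\<close> the only cell is
    the whole space.\<close>
  proof (cases "I = {}")
    case True
    then show ?thesis using A by (simp add: E_def prob_space)
  next
    case False
    \<comment> \<open>\<open>{i \<in> A}\<close> is the singleton of a truth value, so its preimage
      under \<open>X i\<close> is the event that \<open>X i\<close> has the outcome prescribed by
      \<open>A\<close>.\<close>
    have single: "prob (X i -` {i \<in> A} \<inter> space M) = (if i \<in> A then q else 1 - q)" if "i \<in> I" for i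
    proof (cases "i \<in> A")
      case True
      have "X i -` {i \<in> A} \<inter> space M = {\<omega> \<in> space M. X i \<omega>}" using True by auto
      then show ?thesis using True q[OF that] by simp
    next
      case False
      have "X i -` {i \<in> A} \<inter> space M = {\<omega> \<in> space M. \<not> X i \<omega>}" using False by auto
      then show ?thesis using False q[OF that] prob_neg[of "X i"] meas[OF that]
        by (simp add: pred_def)
    qed
    have "E A = (\<Inter>i\<in>I. X i -` {i \<in> A} \<inter> space M)"
      using False unfolding E_eq[OF A] by auto
    then have "prob (E A) = (\<Prod>i\<in>I. prob (X i -` {i \<in> A} \<inter> space M))"
      using indep_varsD[OF indep False fin subset_refl, of "\<lambda>i. {i \<in> A}"] by simp
    also have "\<dots> = (\<Prod>i\<in>I. if i \<in> A then q else 1 - q)"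
      by (intro prod.cong refl single)
    also have "\<dots> = (\<Prod>i\<in>A. q) * (\<Prod>i\<in>I - A. 1 - q)"
      using A fin by (subst prod.subset_diff[OF A fin]) (auto simp: mult.commute)
    finally show ?thesis
      using A fin by (simp add: card_Diff_subset finite_subset)
  qed
  let ?F = "{A \<in> Pow I. P (card A)}"
  have "{\<omega> \<in> space M. P (card {i \<in> I. X i \<omega>})} = (\<Union>A\<in>?F. E A)"
    by (auto simp: E_def)
  then have "prob {\<omega> \<in> space M. P (card {i \<in> I. X i \<omega>})} = (\<Sum>A\<in>?F. prob (E A))"
    using fin E_sets
    by (simp only:) (intro finite_measure_finite_Union, auto simp: disjoint_family_on_def E_def)
  also have "\<dots> = (\<Sum>A\<in>?F. q ^ card A * (1 - q) ^ (card I - card A))"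
    by (intro sum.cong) (auto simp: prob_E)
  \<comment> \<open>Grouping the cells by size leaves \<open>card I choose k\<close> equal terms for
    each \<open>k\<close>.\<close>
  also have "\<dots> = (\<Sum>k | k \<le> card I \<and> P k.
      \<Sum>A | A \<in> ?F \<and> card A = k. q ^ card A * (1 - q) ^ (card I - card A))"
    by (rule sum.group[symmetric]) (use fin in \<open>auto intro: card_mono\<close>)
  also have "\<dots> = (\<Sum>k | k \<le> card I \<and> P k. real (card I choose k) * q ^ k * (1 - q) ^ (card I - k))"
  proof (intro sum.cong refl)
    fix k assume k: "k \<in> {k. k \<le> card I \<and> P k}"
    have "{A. A \<in> ?F \<and> card A = k} = {A. A \<subseteq> I \<and> card A = k}" using k by auto
    then show "(\<Sum>A | A \<in> ?F \<and> card A = k. q ^ card A * (1 - q) ^ (card I - card A)) =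
        real (card I choose k) * q ^ k * (1 - q) ^ (card I - k)"
      using n_subsets[OF fin, of k] by simp
  qed
  finally show ?thesis .
qed

section \<open>Ordered transmission decides as the unordered system does\<close>

lemma sent_decision_le_1: "sent_decision S i \<omega> \<le> 1"
  by (simp add: sent_decision_def local_decision_def)

text \<open>Sorting preserves the multiset of sensors, so the order of transmission does not affect
  the total.\<close>

lemma sum_list_transmission_order:
  "(\<Sum>i\<leftarrow>transmission_order S \<omega>. f i) = (\<Sum>i<nsensors S. f i :: nat)"
proof -
  have "(\<Sum>i\<leftarrow>transmission_order S \<omega>. f i) = (\<Sum>i\<leftarrow>[0..<nsensors S]. f i)"
    unfolding transmission_order_def sum_mset_sum_list[symmetric] by simp
  then show ?thesis
    by (simp add: interv_sum_list_conv_sum_set_nat atLeast0LessThan)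
qed

lemma length_transmission_order: "length (transmission_order S \<omega>) = nsensors S"
  by (simp add: transmission_order_def)

text \<open>The total splits into the part already received and the remaining \<open>N - k\<close>
  decisions, each of which contributes 0 or 1.\<close>

lemma received_ones_bounds:
  assumes "k \<le> nsensors S"
  shows "received_ones S k \<omega> \<le> int (\<Sum>i<nsensors S. sent_decision S i \<omega>)"
    and "int (\<Sum>i<nsensors S. sent_decision S i \<omega>)
      \<le> received_ones S k \<omega> + (int (nsensors S) - int k)"
proof -
  let ?ts = "transmission_order S \<omega>" and ?u = "\<lambda>i. sent_decision S i \<omega>"
  have split: "(\<Sum>i<nsensors S. ?u i) = (\<Sum>i\<leftarrow>take k ?ts. ?u i) + (\<Sum>i\<leftarrow>drop k ?ts. ?u i)"
    by (metis append_take_drop_id map_append sum_list_append sum_list_transmission_order)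
  have "(\<Sum>i\<leftarrow>drop k ?ts. ?u i) \<le> (\<Sum>i\<leftarrow>drop k ?ts. 1)"
    by (intro sum_list_mono sent_decision_le_1)
  then have "(\<Sum>i\<leftarrow>drop k ?ts. ?u i) \<le> nsensors S - k"
    by (simp add: sum_list_triv length_transmission_order)
  with split assms show
    "received_ones S k \<omega> \<le> int (\<Sum>i<nsensors S. sent_decision S i \<omega>)"
    "int (\<Sum>i<nsensors S. sent_decision S i \<omega>)
      \<le> received_ones S k \<omega> + (int (nsensors S) - int k)"
    unfolding received_ones_def by linarith+
qed

text \<open>Either comparison is monotone in its first argument and invariant under a common shift.
  If \<open>R\<close> holds between the ones received and \<open>T\<close>, it holds for the larger
  total. If it fails against \<open>T - (N - k)\<close>, it still fails against \<open>T\<close>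
  after the at most \<open>N - k\<close> missing ones are added.\<close>

lemma eeot_decides_H1_eq_unordered:
  assumes "1 \<le> nsensors S" and R: "R \<in> {(>), (\<ge>)}"
  shows "eeot_decides_H1 S R T = unordered_decides_H1 S R T"
proof
  fix \<omega>
  let ?stops = "\<lambda>k. 1 \<le> k \<and> (eeot_can_decide_H1 S R T k \<omega> \<or> eeot_can_decide_H0 S R T k \<omega>)"
  define k where "k = eeot_stop S R T \<omega>"
  \<comment> \<open>At \<open>k = N\<close> the two stopping conditions are complementary, so the
    \<open>LEAST\<close> in \<open>eeot_stop\<close> ranges over a nonempty set and is at most
    \<open>N\<close>.\<close>
  have stops_N: "?stops (nsensors S)"
    using assms by (auto simp: eeot_can_decide_H1_def eeot_can_decide_H0_def)
  have "?stops k"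
    unfolding k_def eeot_stop_def by (rule LeastI[of ?stops, OF stops_N])
  moreover have "k \<le> nsensors S"
    unfolding k_def eeot_stop_def by (rule Least_le[of ?stops, OF stops_N])
  note received_ones_bounds[OF this, of \<omega>]
  ultimately show "eeot_decides_H1 S R T \<omega> = unordered_decides_H1 S R T \<omega>"
    using R unfolding eeot_decides_H1_def unordered_decides_H1_def k_def[symmetric]
      eeot_can_decide_H1_def eeot_can_decide_H0_def
    by auto
qed

section \<open>Decisions as measurable conditions on the data of one sensor\<close>

definition decision_region :: "'a detection_system \<Rightarrow> real set" where
  "decision_region S = {x. ln (normal_density (obs_mean S 1) (noise S) x /
     normal_density (obs_mean S 0) (noise S) x) > local_threshold S}"

text \<open>The flags \<open>(True, True)\<close> are the only ones that invert the local decision.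
  Writing the region as a disjoint union of two rectangles lets a product law be evaluated on it
  factor by factor.\<close>

definition sent_region :: "'a detection_system \<Rightarrow> (real \<times> bool \<times> bool) set" where
  "sent_region S = decision_region S \<times> (- {(True, True)}) \<union> (- decision_region S) \<times> {(True, True)}"

lemma decision_region_sets [measurable]: "decision_region S \<in> sets borel"
  unfolding decision_region_def by measurable

lemma sets_count_space_pair [simp]:
  "sets (count_space (UNIV :: 'a::countable set) \<Otimes>\<^sub>M count_space (UNIV :: 'b::countable set)) = UNIV"
  by (subst pair_measure_countable) simp_all

text \<open>Makes every set of flag pairs measurable, so that \<open>C\<close> can be arbitrary in
  \<open>cond_prob_sensor_rectangle\<close>.\<close>

lemma sets_pair_measure_pmf [simp]:
  fixes P :: "'a::countable pmf" and Q :: "'b::countable pmf"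
  shows "sets (measure_pmf P \<Otimes>\<^sub>M measure_pmf Q) = UNIV"
  using sets_pair_measure_cong[OF sets_measure_pmf_count_space sets_measure_pmf_count_space]
  by (metis sets_count_space_pair)

lemma sent_region_sets [measurable]: "sent_region S \<in> sets sensor_space"
  unfolding sent_region_def by (intro sets.Un pair_measureI) auto

lemma local_decision_eq_1: "local_decision S i \<omega> = 1 \<longleftrightarrow> obs S i \<omega> \<in> decision_region S"
  by (simp add: local_decision_def llr_def decision_region_def)

lemma local_decision_eq_0: "local_decision S i \<omega> = 0 \<longleftrightarrow> obs S i \<omega> \<notin> decision_region S"
  by (simp add: local_decision_def llr_def decision_region_def)

lemma sent_decision_eq_1: "sent_decision S i \<omega> = 1 \<longleftrightarrow> sensor_data S i \<omega> \<in> sent_region S"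
  using local_decision_eq_1[of S i \<omega>] local_decision_eq_0[of S i \<omega>]
  by (auto simp: sent_decision_def sent_region_def local_decision_def split: if_splits)

lemma sent_decision_eq_0: "sent_decision S i \<omega> = 0 \<longleftrightarrow> sensor_data S i \<omega> \<notin> sent_region S"
  using sent_decision_eq_1[of S i \<omega>] sent_decision_le_1[of S i \<omega>] by force

lemma space_given_hyp [simp]: "space (given_hyp S h) = space (pspace S)"
  and sets_given_hyp [simp]: "sets (given_hyp S h) = sets (pspace S)"
  by (simp_all add: given_hyp_def)

lemma detection_modelD:
  assumes "detection_model S"
  shows "prob_space (pspace S)" "1 \<le> nsensors S"
    "hyp S \<in> pspace S \<rightarrow>\<^sub>M count_space UNIV"
    "0 < noise S" "0 \<le> p_mal S" "p_mal S \<le> 1" "0 \<le> p_flip S" "p_flip S \<le> 1"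
    "h \<in> {0, 1} \<Longrightarrow> 0 < prior S h"
    "i < nsensors S \<Longrightarrow> sensor_data S i \<in> pspace S \<rightarrow>\<^sub>M sensor_space"
    "h \<in> {0, 1} \<Longrightarrow> prob_space.indep_vars (given_hyp S h) (\<lambda>_. sensor_space)
       (sensor_data S) {..<nsensors S}"
    "h \<in> {0, 1} \<Longrightarrow> i < nsensors S \<Longrightarrow> distr (given_hyp S h) sensor_space (sensor_data S i) =
       density lborel (normal_density (obs_mean S h) (noise S)) \<Otimes>\<^sub>M
         (measure_pmf (bernoulli_pmf (p_mal S)) \<Otimes>\<^sub>M measure_pmf (bernoulli_pmf (p_flip S)))"
  using assms unfolding detection_model_def by blast+

section \<open>Laws conditional on a hypothesis\<close>

context
  fixes S :: "'a detection_system" and h :: nat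
  assumes model: "detection_model S" and h: "h \<in> {0, 1}"
begin

lemma hyp_event: "{\<omega> \<in> space (pspace S). hyp S \<omega> = h} \<in> sets (pspace S)"
  using detection_modelD(3)[OF model] by measurable

lemma prob_space_given_hyp: "prob_space (given_hyp S h)"
proof -
  interpret prob_space "pspace S" by (rule detection_modelD(1)[OF model])
  show ?thesis
    unfolding given_hyp_def
    using detection_modelD(9)[OF model h]
    by (intro prob_space_uniform_measure) (auto simp: prior_def emeasure_eq_measure)
qed

text \<open>Both sides are the same quotient of probabilities, the prior being positive. This moves
  conditional probabilities to \<open>given_hyp S h\<close>, the measure under which the model
  states independence.\<close>

lemma cond_prob_eq_given_hyp:
  assumes "{\<omega> \<in> space (pspace S). Q \<omega>} \<in> sets (pspace S)"
  shows "\<P>(\<omega> in pspace S. Q \<omega> \<bar> hyp S \<omega> = h) = measure (given_hyp S h) {\<omega> \<in> space (pspace S). Q \<omega>}"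
proof -
  interpret prob_space "pspace S" by (rule detection_modelD(1)[OF model])
  show ?thesis
    unfolding cond_prob_def given_hyp_def
    using detection_modelD(9)[OF model h] assms hyp_event
    by (subst measure_uniform_measure)
       (auto simp: prior_def emeasure_eq_measure intro!: arg_cong2[of _ _ _ _ "(/)"] arg_cong[of _ _ prob])
qed

lemma sensor_event:
  assumes "i < nsensors S" and "B \<in> sets sensor_space"
  shows "{\<omega> \<in> space (pspace S). sensor_data S i \<omega> \<in> B} \<in> sets (pspace S)"
  using detection_modelD(10)[OF model assms(1)] assms(2) by measurable

lemma cond_prob_sensor_event:
  assumes i: "i < nsensors S" and B: "B \<in> sets sensor_space"
  shows "\<P>(\<omega> in pspace S. sensor_data S i \<omega> \<in> B \<bar> hyp S \<omega> = h) =
    measure (density lborel (normal_density (obs_mean S h) (noise S)) \<Otimes>\<^sub>M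
      (measure_pmf (bernoulli_pmf (p_mal S)) \<Otimes>\<^sub>M measure_pmf (bernoulli_pmf (p_flip S)))) B"
proof -
  have "sensor_data S i \<in> given_hyp S h \<rightarrow>\<^sub>M sensor_space"
    using detection_modelD(10)[OF model i] by (simp cong: measurable_cong_sets)
  then have "measure (distr (given_hyp S h) sensor_space (sensor_data S i)) B =
      measure (given_hyp S h) {\<omega> \<in> space (pspace S). sensor_data S i \<omega> \<in> B}"
    using B by (subst measure_distr) (auto intro!: arg_cong[of _ _ "measure _"])
  then show ?thesis
    using cond_prob_eq_given_hyp[OF sensor_event[OF i B]] detection_modelD(12)[OF model h i]
    by simp
qed

lemma cond_prob_sensor_rectangle:
  assumes i: "i < nsensors S" and V: "V \<in> sets borel"
  shows "\<P>(\<omega> in pspace S. sensor_data S i \<omega> \<in> V \<times> C \<bar> hyp S \<omega> = h) =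
    measure (density lborel (normal_density (obs_mean S h) (noise S))) V *
    measure (measure_pmf (bernoulli_pmf (p_mal S)) \<Otimes>\<^sub>M measure_pmf (bernoulli_pmf (p_flip S))) C"
proof -
  let ?N = "density lborel (normal_density (obs_mean S h) (noise S))"
  let ?B = "measure_pmf (bernoulli_pmf (p_mal S)) \<Otimes>\<^sub>M measure_pmf (bernoulli_pmf (p_flip S))"
  interpret B: prob_space ?B
    by (intro prob_space_pair prob_space_measure_pmf)
  have "C \<in> sets ?B"
    by simp
  then have "measure (?N \<Otimes>\<^sub>M ?B) (V \<times> C) = measure ?N V * measure ?B C"
    using V by (simp add: measure_def B.emeasure_pair_measure_Times enn2real_mult)
  moreover have "V \<times> C \<in> sets sensor_space"
    using V by (intro pair_measureI) auto
  ultimately show ?thesis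
    using cond_prob_sensor_event[OF i, of "V \<times> C"] by (simp only:)
qed

lemma pi_local_eq:
  assumes i: "i < nsensors S"
  defines "D \<equiv> density lborel (normal_density (obs_mean S h) (noise S))"
  shows "pi_local S i 1 h = measure D (decision_region S)"
    and "pi_local S i 0 h = measure D (- decision_region S)"
proof -
  let ?B = "measure_pmf (bernoulli_pmf (p_mal S)) \<Otimes>\<^sub>M measure_pmf (bernoulli_pmf (p_flip S))"
  interpret B: prob_space ?B
    by (intro prob_space_pair prob_space_measure_pmf)
  have "measure ?B UNIV = 1"
    using B.prob_space by (simp add: space_pair_measure)
  \<comment> \<open>The full set of flags is used as the second side of the rectangle, which leaves
    the marginal law of the observation.\<close>
  then have "\<P>(\<omega> in pspace S. obs S i \<omega> \<in> V \<bar> hyp S \<omega> = h) = measure D V" if "V \<in> sets borel" for V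
    using cond_prob_sensor_rectangle[OF i that, of UNIV] by (simp add: D_def)
  from this[of "decision_region S"] this[of "- decision_region S"]
  show "pi_local S i 1 h = measure D (decision_region S)"
    "pi_local S i 0 h = measure D (- decision_region S)"
    unfolding pi_local_def local_decision_eq_1 local_decision_eq_0 by auto
qed

text \<open>A sent decision is 0 or 1, so the two events are complementary under the probability
  measure \<open>given_hyp S h\<close>.\<close>

lemma pi_sent_0:
  assumes i: "i < nsensors S"
  shows "pi_sent S i 0 h = 1 - pi_sent S i 1 h"
proof -
  interpret G: prob_space "given_hyp S h" by (rule prob_space_given_hyp)
  have ev: "{\<omega> \<in> space (pspace S). sensor_data S i \<omega> \<in> B} \<in> sets (pspace S)"
    if "B \<in> sets sensor_space" for B
    using sensor_event[OF i that] .
  have "{\<omega> \<in> space (pspace S). sensor_data S i \<omega> \<notin> sent_region S} \<in> sets (pspace S)"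
    using ev[OF sent_region_sets[of S]] by (rule sets.sets_Collect_neg)
  then show ?thesis
    unfolding pi_sent_def sent_decision_eq_1 sent_decision_eq_0
    using ev[OF sent_region_sets[of S]]
      G.prob_neg[of "\<lambda>\<omega>. sensor_data S i \<omega> \<in> sent_region S"]
    by (simp add: cond_prob_eq_given_hyp)
qed

text \<open>A one is sent either by flipping a local 0, with flags \<open>(True, True)\<close>, or
  by keeping a local 1, with any other flags. The flags are independent of the observation, so each
  case contributes a product.\<close>

lemma pi_sent_1:
  assumes i: "i < nsensors S"
  shows "pi_sent S i 1 h =
    p_mal S * p_flip S * pi_local S i 0 h + (1 - p_mal S * p_flip S) * pi_local S i 1 h"
proof -
  let ?N = "density lborel (normal_density (obs_mean S h) (noise S))"
  let ?B1 = "measure_pmf (bernoulli_pmf (p_mal S))"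
  let ?B2 = "measure_pmf (bernoulli_pmf (p_flip S))"
  let ?V = "decision_region S"
  interpret G: prob_space "given_hyp S h" by (rule prob_space_given_hyp)
  interpret B: prob_space "?B1 \<Otimes>\<^sub>M ?B2"
    by (intro prob_space_pair prob_space_measure_pmf)
  have "measure (?B1 \<Otimes>\<^sub>M ?B2) ({True} \<times> {True}) = measure ?B1 {True} * measure ?B2 {True}"
    by (simp only: measure_def measure_pmf.emeasure_pair_measure_Times sets_measure_pmf UNIV_I enn2real_mult)
  then have flip: "measure (?B1 \<Otimes>\<^sub>M ?B2) {(True, True)} = p_mal S * p_flip S"
    using detection_modelD(5-8)[OF model] by (simp add: measure_pmf_single)
  have keep: "measure (?B1 \<Otimes>\<^sub>M ?B2) (- {(True, True)}) = 1 - p_mal S * p_flip S"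
    using B.prob_compl[of "{(True, True)}"] flip by (simp add: space_pair_measure Compl_eq_Diff_UNIV)
  have rect: "?V \<times> - {(True, True)} \<in> sets sensor_space"
    "(- ?V) \<times> {(True, True)} \<in> sets sensor_space"
    by (intro pair_measureI; simp)+
  let ?E = "\<lambda>B. {\<omega> \<in> space (pspace S). sensor_data S i \<omega> \<in> B}"
  have "measure (given_hyp S h) (?E (sent_region S)) =
      measure (given_hyp S h) (?E (?V \<times> - {(True, True)}) \<union> ?E ((- ?V) \<times> {(True, True)}))"
    by (intro arg_cong[of _ _ "measure _"]) (auto simp: sent_region_def)
  also have "\<dots> = measure (given_hyp S h) (?E (?V \<times> - {(True, True)})) +
      measure (given_hyp S h) (?E ((- ?V) \<times> {(True, True)}))"
    using sensor_event[OF i rect(1)] sensor_event[OF i rect(2)]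
    by (intro G.finite_measure_Union) auto
  finally have "pi_sent S i 1 h =
      \<P>(\<omega> in pspace S. sensor_data S i \<omega> \<in> ?V \<times> - {(True, True)} \<bar> hyp S \<omega> = h) +
      \<P>(\<omega> in pspace S. sensor_data S i \<omega> \<in> (- ?V) \<times> {(True, True)} \<bar> hyp S \<omega> = h)"
    unfolding pi_sent_def sent_decision_eq_1
    by (simp only: cond_prob_eq_given_hyp[OF sensor_event[OF i]] rect sent_region_sets)
  also have "\<dots> = pi_local S i 1 h * (1 - p_mal S * p_flip S) + pi_local S i 0 h * (p_mal S * p_flip S)"
    by (simp only: cond_prob_sensor_rectangle[OF i] pi_local_eq[OF i] flip keep
        decision_region_sets borel_comp)
  finally show ?thesis by (simp add: mult.commute)
qed

text \<open>The sent decisions are one fixed function of the conditionally i.i.d. sensor data, so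
  the number of ones is binomial. Sensor \<open>m\<close> serves as a representative for the common
  success probability.\<close>

lemma cond_prob_unordered_decides_H1:
  assumes m: "m < nsensors S"
  defines "N \<equiv> nsensors S"
  shows "\<P>(\<omega> in pspace S. unordered_decides_H1 S (>) T \<omega> \<bar> hyp S \<omega> = h) =
    (\<Sum>i=T+1..N. real (N choose i) * pi_sent S m 1 h ^ i * pi_sent S m 0 h ^ (N - i))"
proof -
  interpret G: prob_space "given_hyp S h" by (rule prob_space_given_hyp)
  let ?X = "\<lambda>i \<omega>. sensor_data S i \<omega> \<in> sent_region S"
  have indep: "G.indep_vars (\<lambda>_. count_space UNIV) ?X {..<N}"
    using G.indep_vars_compose2[OF detection_modelD(11)[OF model h],
        of "\<lambda>_ z. z \<in> sent_region S" "\<lambda>_. count_space UNIV"]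
    by (simp add: N_def)
  have law: "measure (given_hyp S h) {\<omega> \<in> space (given_hyp S h). ?X i \<omega>} = pi_sent S m 1 h"
    if "i \<in> {..<N}" for i
  proof -
    have i: "i < nsensors S" using that by (simp add: N_def)
    have "pi_sent S i 1 h = pi_sent S m 1 h"
      \<comment> \<open>Both sides reduce to the same Gaussian measures and flag probabilities, in
        which the sensor index no longer occurs.\<close>
      by (simp only: pi_sent_1 pi_local_eq i m)
    then show ?thesis
      using cond_prob_eq_given_hyp[OF sensor_event[OF i sent_region_sets[of S]]]
      unfolding pi_sent_def sent_decision_eq_1 by simp
  qed
  have sum_eq: "(\<Sum>i<N. sent_decision S i \<omega>) = card {i \<in> {..<N}. ?X i \<omega>}" for \<omega>
  proof -
    have "(\<Sum>i<N. sent_decision S i \<omega>) = (\<Sum>i<N. if ?X i \<omega> then 1 else 0)"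
      by (intro sum.cong refl) (metis sent_decision_eq_1 sent_decision_eq_0)
    then show ?thesis by (simp add: sum.If_cases Int_def)
  qed
  have dec: "unordered_decides_H1 S (>) T \<omega> \<longleftrightarrow> T < card {i \<in> {..<N}. ?X i \<omega>}" for \<omega>
    unfolding unordered_decides_H1_def N_def[symmetric] sum_eq by simp
  have "{\<omega> \<in> space (pspace S). T < card {i \<in> {..<N}. ?X i \<omega>}} \<in> sets (pspace S)"
  proof -
    have [measurable]: "Measurable.pred (pspace S) (?X i)" if "i \<in> {..<N}" for i
      using sensor_event[OF _ sent_region_sets] that by (simp add: pred_def N_def)
    \<comment> \<open>The random cardinality is measurable because it is a finite sum of
      indicators.\<close>
    have "(\<lambda>\<omega>. \<Sum>i<N. if ?X i \<omega> then 1 else 0 :: nat) \<in> pspace S \<rightarrow>\<^sub>M count_space UNIV"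
      by measurable
    then have "(\<lambda>\<omega>. card {i \<in> {..<N}. ?X i \<omega>}) \<in> pspace S \<rightarrow>\<^sub>M count_space UNIV"
      by (simp add: sum.If_cases Int_def)
    then show ?thesis by measurable
  qed
  then have "\<P>(\<omega> in pspace S. unordered_decides_H1 S (>) T \<omega> \<bar> hyp S \<omega> = h) =
      measure (given_hyp S h) {\<omega> \<in> space (given_hyp S h). T < card {i \<in> {..<N}. ?X i \<omega>}}"
    unfolding dec space_given_hyp by (rule cond_prob_eq_given_hyp)
  also have "\<dots> = (\<Sum>i | i \<le> N \<and> T < i.
      real (N choose i) * pi_sent S m 1 h ^ i * (1 - pi_sent S m 1 h) ^ (N - i))"
    using G.prob_card_indep_events[OF indep finite_lessThan law, of "\<lambda>k. T < k"]
    unfolding card_lessThan .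
  \<comment> \<open>The strict comparison assigns a count equal to \<open>T\<close> to hypothesis 0,
    hence the lower limit \<open>T+1\<close>; for \<open>T \<ge> N\<close> the sum is empty.\<close>
  also have "{i. i \<le> N \<and> T < i} = {T+1..N}" by auto
  finally show ?thesis by (simp only: pi_sent_0[OF m])
qed

end

theorem mainTheorem6:
  fixes S :: "'a detection_system" and N T m :: nat and \<alpha> p :: real
  assumes "detection_model S"
    and "N = nsensors S" and "\<alpha> = p_mal S" and "p = p_flip S"
    and "m < N"
  shows
    "(\<forall>h\<in>{0, 1}.
        pi_sent S m 1 h = \<alpha> * p * pi_local S m 0 h + (1 - \<alpha> * p) * pi_local S m 1 h \<and>
        pi_sent S m 0 h = 1 - pi_sent S m 1 h) \<and>
     (\<forall>R\<in>{(>), (\<ge>)}.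
        prob_detection S (eeot_decides_H1 S R T) =
          prob_detection S (unordered_decides_H1 S R T) \<and>
        prob_false_alarm S (eeot_decides_H1 S R T) =
          prob_false_alarm S (unordered_decides_H1 S R T)) \<and>
     prob_detection S (eeot_decides_H1 S (>) T) =
       (\<Sum>i=T+1..N. real (N choose i) * pi_sent S m 1 1 ^ i * pi_sent S m 0 1 ^ (N - i)) \<and>
     prob_false_alarm S (eeot_decides_H1 S (>) T) =
       (\<Sum>i=T+1..N. real (N choose i) * pi_sent S m 1 0 ^ i * pi_sent S m 0 0 ^ (N - i))"
proof -
  have m: "m < nsensors S" and N: "1 \<le> nsensors S" using assms(2,5) by simp_all
  \<comment> \<open>The two decisions coincide as functions on outcomes, so all their probabilities
    agree under either tie convention.\<close>
  have eeot: "eeot_decides_H1 S R T = unordered_decides_H1 S R T" if "R \<in> {(>), (\<ge>)}" for R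
    using eeot_decides_H1_eq_unordered[OF N that] .
  have law: "\<P>(\<omega> in pspace S. unordered_decides_H1 S (>) T \<omega> \<bar> hyp S \<omega> = h) =
      (\<Sum>i=T+1..N. real (N choose i) * pi_sent S m 1 h ^ i * pi_sent S m 0 h ^ (N - i))"
    if "h \<in> {0, 1}" for h
    unfolding assms(2) using cond_prob_unordered_decides_H1[OF assms(1) that m] .
  show ?thesis
    unfolding assms(3,4)
  proof (intro conjI ballI)
    fix h :: nat assume h: "h \<in> {0, 1}"
    show "pi_sent S m 1 h = p_mal S * p_flip S * pi_local S m 0 h +
        (1 - p_mal S * p_flip S) * pi_local S m 1 h"
      by (rule pi_sent_1[OF assms(1) h m])
    show "pi_sent S m 0 h = 1 - pi_sent S m 1 h"
      by (rule pi_sent_0[OF assms(1) h m])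
  qed (simp_all only: eeot prob_detection_def prob_false_alarm_def law insertI1 insertI2)
qed

end
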